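(* Let $n\ge1$, $x_0>0$, and let $\phi:[x_0,\infty)\to(0,\infty)$ be a (continuous) piecewise $C^1$ function such that $x\mapsto x\phi(x)$ is non-increasing. Put $$t_0=\ln\left(\frac{2}{\sqrt{n+1}\,\phi(x_0)}\right)$$ and define $\rho:[t_0,\infty)\to(0,\infty)$ by $$\rho(t)=e^{-t}\cdot\phi^{-1}\left(\frac{2}{\sqrt{n+1}\,e^{t}}\right).$$ Then $\rho$ is non-increasing, and for every $\alpha\in S^n$ the following hold: (i) If $\alpha\in A(\phi,S^n)$, then there exists a sequence $t_k\to\infty$ such that $\omega(g_{t_k}r_\alpha\Lambda_0)<2\rho(t_k)$. (ii) If there exists a sequence $t_k\to\infty$ such that $\omega(g_{t_k}r_\alpha\Lambda_0)<\rho(t_k)$, then $\alpha\in A(\sqrt{n+1}\,\phi,S^n)$.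
   Context: $S^n\subset\mathbb{R}^{n+1}$ is the Euclidean unit sphere; $\|\cdot\|$ is the supremum norm (on $\mathbb{R}^{n+1}$ or $\mathbb{R}^{n+2}$). For a function $\phi$ defined on $[x_0,\infty)$, $A(\phi,S^n)$ is the set of $\alpha\in S^n$ for which there exist infinitely many $(\mathbf{p},q)\in\mathbb{Z}^{n+1}\times\mathbb{N}$ (with $q\ge x_0$) such that $\frac{\mathbf{p}}{q}\in S^n$ and $\left\|\alpha-\frac{\mathbf{p}}{q}\right\|<\phi(q)$. The assumption on $\phi$ makes it strictly decreasing with $\phi(x)\to0$, so $\phi^{-1}:(0,\phi(x_0)]\to[x_0,\infty)$ is well defined. Let $Q(\mathbf{x})=\sum_{i=1}^{n+1}x_i^2-x_{n+2}^2$ on $\mathbb{R}^{n+2}$, $L=\{\mathbf{x}\in\mathbb{R}^{n+2}:Q(\mathbf{x})=0\}$, $\Lambda_0=\mathbb{Z}^{n+2}\cap L$, and let $G=\mathrm{SO}(Q)$ be the group of orientation-preserving linear transformations of $\mathbb{R}^{n+2}$ preserving $Q$. A lattice in $L$ is a set of the form $\Lambda=g\Lambda_0$, $g\in G$, and $\omega(\Lambda):=\min_{0\ne\mathbf{v}\in\Lambda}\|\mathbf{v}\|$. For $t\in\mathbb{R}$, $$g_t=\begin{pmatrix}\cosh t&0&-\sinh t\\0&I_n&0\\-\sinh t&0&\cosh t\end{pmatrix}\in G.$$ For $\alpha\in S^n$, $r_\alpha$ denotes an element of $G$ which preserves $\mathbb{R}^{n+1}\times\{0\}$ and sends $(\alpha,1)$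 to $(1,0,\dots,0,1)$. *)

theory Defs
  imports "HOL-Analysis.Analysis"
begin

text \<open>
  The index type \<open>'n\<close> has \<open>n = CARD('n) \<ge> 1\<close> elements. In \<open>\<real>\<^sup>n\<^sup>+\<^sup>1\<close> the coordinate
  \<open>None\<close> is the first one; \<open>\<real>\<^sup>n\<^sup>+\<^sup>2\<close> adjoins to the coordinates \<open>Some i\<close> of
  \<open>\<real>\<^sup>n\<^sup>+\<^sup>1\<close> a last coordinate \<open>None\<close>. Thus the first coordinate
  of \<open>\<real>\<^sup>n\<^sup>+\<^sup>2\<close> is \<open>Some None\<close>.
  The supremum norm is \<^const>\<open>infnorm\<close>.
\<close>

type_synonym 'n vec1 = "real ^ 'n option"
type_synonym 'n vec2 = "real ^ 'n option option"
type_synonym 'n mat2 = "real ^ 'n option option ^ 'n option option"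

definition snoc :: "'n::finite vec1 \<Rightarrow> real \<Rightarrow> 'n vec2" where
  "snoc x a = (\<chi> i. case i of None \<Rightarrow> a | Some j \<Rightarrow> x $ j)"

definition int_vecs :: "(real ^ 'm::finite) set" where
  "int_vecs = {x. \<forall>i. x $ i \<in> \<int>}"

definition approximable :: "real \<Rightarrow> (real \<Rightarrow> real) \<Rightarrow> ('n::finite vec1) set" where
  "approximable x0 \<phi> = {\<alpha> \<in> sphere 0 1.
     infinite {(p, q :: nat). p \<in> int_vecs \<and> q \<ge> 1 \<and> real q \<ge> x0 \<and>
       p /\<^sub>R real q \<in> sphere 0 1 \<and> infnorm (\<alpha> - p /\<^sub>R real q) < \<phi> (real q)}}"

definition Q :: "'n::finite vec2 \<Rightarrow> real" where
  "Q x = (\<Sum>i\<in>UNIV. (x $ Some i)\<^sup>2) - (x $ None)\<^sup>2"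

definition light_cone :: "('n::finite vec2) set" where
  "light_cone = {x. Q x = 0}"

definition \<Lambda>\<^sub>0 :: "('n::finite vec2) set" where
  "\<Lambda>\<^sub>0 = int_vecs \<inter> light_cone"

definition SO_Q :: "('n::finite mat2) set" where
  "SO_Q = {g. det g > 0 \<and> (\<forall>x. Q (g *v x) = Q x)}"

text \<open>The minimum of the norm over nonzero vectors; that it exists for the
  lattices \<open>g \<Lambda>\<^sub>0\<close> is lemma \<open>\<omega>_attained\<close> below.\<close>

definition \<omega> :: "('n::finite vec2) set \<Rightarrow> real" where
  "\<omega> \<Lambda> = (LEAST s. s \<in> infnorm ` (\<Lambda> - {0}))"

definition flow :: "real \<Rightarrow> 'n::finite mat2" where
  "flow t = (\<chi> i j. case (i, j) of
      (Some None, Some None) \<Rightarrow> cosh t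
    | (Some None, None) \<Rightarrow> - sinh t
    | (None, Some None) \<Rightarrow> - sinh t
    | (None, None) \<Rightarrow> cosh t
    | _ \<Rightarrow> if i = j then 1 else 0)"

text \<open>The possible choices of \<open>r\<^sub>\<alpha>\<close>.\<close>

definition rotations_to_axis :: "'n::finite vec1 \<Rightarrow> ('n mat2) set" where
  "rotations_to_axis \<alpha> = {r \<in> SO_Q.
     (\<lambda>v. r *v v) ` range (\<lambda>x. snoc x 0) = range (\<lambda>x. snoc x 0) \<and>
     r *v snoc \<alpha> 1 = snoc (axis None 1) 1}"

lemma finite_bounded_int_vecs: "finite {x \<in> int_vecs :: (real ^ 'm::finite) set. norm x \<le> B}"
proof -
  define F where "F = {y :: real. y \<in> \<int> \<and> \<bar>y\<bar> \<le> B}"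
  have "finite F"
    unfolding F_def by (rule finite_abs_int_segment)
  then have "finite (Pi\<^sub>E (UNIV :: 'm set) (\<lambda>_. F))"
    by (intro finite_PiE) auto
  moreover have "{x \<in> int_vecs :: (real ^ 'm) set. norm x \<le> B} \<subseteq> vec_lambda ` (Pi\<^sub>E UNIV (\<lambda>_. F))"
  proof
    fix x :: "real ^ 'm" assume x: "x \<in> {x \<in> int_vecs. norm x \<le> B}"
    then have "x $ i \<in> F" for i
      using component_le_norm_cart[of x i] by (auto simp: F_def int_vecs_def)
    then show "x \<in> vec_lambda ` (Pi\<^sub>E UNIV (\<lambda>_. F))"
      by (intro image_eqI[of _ _ "vec_nth x"]) auto
  qed
  ultimately show ?thesis
    by (rule finite_surj)
qed

lemma \<omega>_attained:
  fixes g :: "'n::finite mat2"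
  assumes "g \<in> SO_Q"
  defines "\<Lambda> \<equiv> (\<lambda>v. g *v v) ` \<Lambda>\<^sub>0"
  shows "\<exists>v\<in>\<Lambda> - {0}. infnorm v = \<omega> \<Lambda> \<and> (\<forall>w\<in>\<Lambda> - {0}. infnorm v \<le> infnorm w)"
proof -
  have inv: "invertible g"
    using assms by (simp add: SO_Q_def invertible_det_nz)
  then have inj: "inj ((*v) g)"
    by (rule inj_matrix_vector_mult)
  then obtain c where c: "c > 0" "\<And>x. norm (g *v x) \<ge> c * norm x"
    using linear_inj_bounded_below_pos[OF matrix_vector_mul_linear] by (metis mult.commute)
  define u :: "'n vec2" where "u = snoc (axis None 1) 1"
  have u: "u \<in> \<Lambda>\<^sub>0" "u \<noteq> 0"
  proof -
    have "u $ None = 1" by (simp add: u_def snoc_def)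
    then show "u \<noteq> 0" by auto
    have "(\<Sum>i\<in>UNIV. (u $ Some i)\<^sup>2) = (\<Sum>i\<in>(UNIV::'n option set). if i = None then 1 else 0)"
      by (rule sum.cong) (auto simp: u_def snoc_def axis_def)
    then have "Q u = 0"
      by (simp add: Q_def u_def snoc_def)
    moreover have "u $ i \<in> \<int>" for i
      by (auto simp: u_def snoc_def axis_def split: option.split)
    ultimately show "u \<in> \<Lambda>\<^sub>0"
      by (simp add: \<Lambda>\<^sub>0_def int_vecs_def light_cone_def)
  qed
  define v0 where "v0 = g *v u"
  have v0: "v0 \<in> \<Lambda> - {0}"
    using u inj by (auto simp: v0_def \<Lambda>_def dest: injD[of _ u 0])
  define M where "M = {v \<in> \<Lambda> - {0}. infnorm v \<le> infnorm v0}"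
  have "M \<subseteq> (\<lambda>v. g *v v) ` {x \<in> int_vecs. norm x \<le> sqrt (DIM('n vec2)) * infnorm v0 / c}"
  proof
    fix v assume "v \<in> M"
    then obtain x where x: "x \<in> \<Lambda>\<^sub>0" "v = g *v x" "infnorm v \<le> infnorm v0"
      by (auto simp: M_def \<Lambda>_def)
    have "c * norm x \<le> norm v" using c x by simp
    also have "\<dots> \<le> sqrt (DIM('n vec2)) * infnorm v" by (rule norm_le_infnorm)
    also have "\<dots> \<le> sqrt (DIM('n vec2)) * infnorm v0" using x by (intro mult_left_mono) auto
    finally have "norm x \<le> sqrt (DIM('n vec2)) * infnorm v0 / c"
      using c by (simp add: field_simps)
    then show "v \<in> (\<lambda>v. g *v v) ` {x \<in> int_vecs. norm x \<le> sqrt (DIM('n vec2)) * infnorm v0 / c}"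
      using x by (auto simp: \<Lambda>\<^sub>0_def)
  qed
  then have "finite M"
    using finite_bounded_int_vecs finite_surj by blast
  moreover have "v0 \<in> M" using v0 by (simp add: M_def)
  ultimately obtain v where v: "v \<in> M" "\<And>w. w \<in> M \<Longrightarrow> infnorm v \<le> infnorm w"
    using ex_min_if_finite[of "infnorm ` M"] by (metis (no_types, lifting) empty_iff finite_imageI imageE image_eqI linorder_not_less)
  have le: "infnorm v \<le> infnorm w" if "w \<in> \<Lambda> - {0}" for w
  proof (cases "w \<in> M")
    case False
    with that have "infnorm v0 < infnorm w" by (auto simp: M_def)
    with v(1) show ?thesis by (auto simp: M_def)
  qed (use v in auto)
  have "\<omega> \<Lambda> = infnorm v"
    unfolding \<omega>_def using v(1) le by (intro Least_equality) (auto simp: M_def)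
  with v(1) le show ?thesis by (auto simp: M_def)
qed

text \<open>Under the standing assumptions, \<open>\<phi>\<close> has a well-defined inverse
  \<open>(0, \<phi> x0] \<rightarrow> [x0, \<infinity>)\<close>.\<close>

lemma \<phi>_bij_betw:
  fixes \<phi> :: "real \<Rightarrow> real"
  assumes "x0 > 0" and pos: "\<And>x. x \<ge> x0 \<Longrightarrow> \<phi> x > 0" and cont: "continuous_on {x0..} \<phi>"
    and mono: "antimono_on {x0..} (\<lambda>x. x * \<phi> x)"
  shows "bij_betw \<phi> {x0..} {0<..\<phi> x0}"
proof -
  have less: "\<phi> y < \<phi> x" if "x0 \<le> x" "x < y" for x y
  proof -
    have "y * \<phi> y \<le> x * \<phi> x" using mono that by (auto simp: monotone_on_def)
    also have "\<dots> < y * \<phi> x" using pos that by auto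
    finally show ?thesis using that \<open>x0 > 0\<close> by auto
  qed
  have "inj_on \<phi> {x0..}"
    by (rule linorder_inj_onI) (use less in fastforce)+
  moreover have "\<phi> ` {x0..} = {0<..\<phi> x0}"
  proof (intro equalityI subsetI)
    fix y assume "y \<in> \<phi> ` {x0..}"
    then obtain x where "y = \<phi> x" "x0 \<le> x" by auto
    then show "y \<in> {0<..\<phi> x0}" using pos less[of x0 x] by (cases "x = x0") auto
  next
    fix y assume y: "y \<in> {0<..\<phi> x0}"
    define b where "b = x0 * \<phi> x0 / y"
    have b: "b \<ge> x0" using y \<open>x0 > 0\<close> by (auto simp: b_def field_simps)
    then have "b * \<phi> b \<le> x0 * \<phi> x0" using mono by (auto simp: monotone_on_def)
    then have "b * \<phi> b \<le> b * y" using y by (simp add: b_def)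
    then have "\<phi> b \<le> y" using b \<open>x0 > 0\<close> by auto
    moreover have "continuous_on {x0..b} \<phi>" using cont by (rule continuous_on_subset) auto
    ultimately obtain x where "x0 \<le> x" "\<phi> x = y"
      using IVT2'[of \<phi> b y x0] b y by auto
    then show "y \<in> \<phi> ` {x0..}" by auto
  qed
  ultimately show ?thesis by (simp add: bij_betw_def)
qed

end

theory Submission
  imports Defs
begin

text \<open>
  Let \<open>p/q\<close> be a rational point of the sphere and \<open>d\<close> its Euclidean distance to \<open>\<alpha>\<close>. As
  \<open>r\<^sub>\<alpha>(p, q) - q(1, 0, \<dots>, 0, 1) = r\<^sub>\<alpha>(p - q\<alpha>, 0)\<close> lies in the horizontal hyperplane and
  \<open>(p, q)\<close> is isotropic, the first and the last coordinate of \<open>g\<^sub>t r\<^sub>\<alpha>(p, q)\<close> are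
  \<open>q (e\<^sup>-\<^sup>t - d\<^sup>2 cosh t / 2)\<close> and \<open>q (e\<^sup>-\<^sup>t + d\<^sup>2 sinh t / 2)\<close>, and the others are at most
  \<open>q d\<close> in absolute value. Hence \<open>d < 2 e\<^sup>-\<^sup>t\<close> forces all of them below \<open>2 q e\<^sup>-\<^sup>t\<close>, which with
  \<open>e\<^sup>t = 2 / (\<surd>(n+1) \<phi>(q))\<close> is (i). Conversely, if all of them are below \<open>\<rho>(t) = e\<^sup>-\<^sup>t X\<close>,
  then \<open>q < X\<close>, and subtracting the first from the last gives
  \<open>d\<^sup>2 < 4 e\<^sup>-\<^sup>2\<^sup>t X / q < (2 e\<^sup>-\<^sup>t X / q)\<^sup>2 \<le> (n+1) \<phi>(q)\<^sup>2\<close> by monotonicity of \<open>x \<phi>(x)\<close>. These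
  solutions have \<open>d \<rightarrow> 0\<close>, so they are infinitely many unless \<open>\<alpha>\<close> is itself rational, in which
  case the multiples of its representation \<open>(p, q)\<close> suffice.
\<close>

section \<open>Coordinates, the supremum norm and the light cone\<close>

lemma sum_UNIV_option:
  "(\<Sum>i\<in>(UNIV :: 'a::finite option set). f i) = f None + (\<Sum>i\<in>UNIV. f (Some i))"
  by (simp add: UNIV_option_conv sum.reindex)

text \<open>A supremum over finitely many coordinates is attained, so even the strict bound can be
  checked coordinate by coordinate.\<close>

lemma infnorm_less_iff:
  fixes x :: "real ^ 'm::finite"
  shows "infnorm x < B \<longleftrightarrow> (\<forall>i. \<bar>x $ i\<bar> < B)"
proof -
  have "{\<bar>x $ i\<bar> |i. i \<in> UNIV} = range (\<lambda>i. \<bar>x $ i\<bar>)"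
    by auto
  then show ?thesis
    by (simp add: infnorm_cart cSup_eq_Max)
qed

lemma snoc_nth [simp]: "snoc x a $ None = a" "snoc x a $ Some j = x $ j"
  by (simp_all add: snoc_def)

lemma snoc_cases:
  obtains x a where "v = snoc x a"
proof -
  have "v = snoc (\<chi> j. v $ Some j) (v $ None)"
    by (simp add: vec_eq_iff snoc_def split: option.split)
  then show thesis by (rule that)
qed

lemma Q_snoc: "Q (snoc x a) = (norm x)\<^sup>2 - a\<^sup>2"
  by (simp add: Q_def norm_vec_def L2_set_def sum_nonneg)

lemma snoc_in_\<Lambda>\<^sub>0_iff: "snoc p a \<in> \<Lambda>\<^sub>0 \<longleftrightarrow> p \<in> int_vecs \<and> a \<in> \<int> \<and> norm p = \<bar>a\<bar>"
proof -
  have "snoc p a \<in> int_vecs \<longleftrightarrow> p \<in> int_vecs \<and> a \<in> \<int>"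
    by (auto simp: int_vecs_def split_option_all)
  moreover have "(norm p)\<^sup>2 = a\<^sup>2 \<longleftrightarrow> norm p = \<bar>a\<bar>"
    by (metis abs_norm_cancel power2_eq_iff power2_abs abs_ge_zero norm_ge_zero power2_eq_imp_eq)
  ultimately show ?thesis
    by (auto simp: \<Lambda>\<^sub>0_def light_cone_def Q_snoc)
qed

section \<open>The hyperbolic flow inside \<open>SO_Q\<close> and short lattice vectors\<close>

lemma flow_mult_nth:
  "(flow t *v x) $ None = cosh t * x $ None - sinh t * x $ Some None"
  "(flow t *v x) $ Some None = cosh t * x $ Some None - sinh t * x $ None"
  "(flow t *v x) $ Some (Some i) = x $ Some (Some i)"
proof -
  have "(\<Sum>j\<in>UNIV. (if i = j then 1 else 0) * x $ Some (Some j)) = x $ Some (Some i)"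
    by (simp add: if_distrib[where f = "\<lambda>a. a * _"] cong: if_cong)
  then show "(flow t *v x) $ Some (Some i) = x $ Some (Some i)"
    by (simp add: matrix_vector_mult_def sum_UNIV_option flow_def)
qed (simp_all add: matrix_vector_mult_def sum_UNIV_option flow_def)

lemma flow_add: "flow s ** flow t = (flow (s + t) :: 'n::finite mat2)"
proof -
  have "(flow s *v (flow t *v x)) $ i = (flow (s + t) *v x) $ i" for x :: "'n vec2" and i
    by (cases i rule: option.exhaust; cases "the i")
      (auto simp: flow_mult_nth cosh_add sinh_add algebra_simps)
  then show ?thesis
    by (simp add: matrix_eq vec_eq_iff flip: matrix_vector_mul_assoc)
qed

text \<open>The one-parameter group law makes \<open>flow t\<close> the square of
  \<open>flow (t / 2)\<close>, which has the inverse \<open>flow (- (t / 2))\<close>; hence the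
  determinant is a nonzero square. This avoids expanding it over the index type.\<close>

lemma det_flow_pos: "det (flow t :: 'n::finite mat2) > 0"
proof -
  have zero: "flow 0 = (mat 1 :: 'n mat2)"
  proof -
    have "(flow 0 *v x) $ i = x $ i" for x :: "'n vec2" and i
      by (cases i rule: option.exhaust; cases "the i") (auto simp: flow_mult_nth)
    then show ?thesis
      by (simp add: matrix_eq vec_eq_iff)
  qed
  have "det (flow (t / 2) :: 'n mat2) * det (flow (- (t / 2)) :: 'n mat2) = 1"
    by (simp add: flow_add zero flip: det_mul)
  then have "det (flow (t / 2) :: 'n mat2) \<noteq> 0" by auto
  moreover have "det (flow t :: 'n mat2) = det (flow (t / 2) :: 'n mat2) * det (flow (t / 2) :: 'n mat2)"
    by (simp add: flow_add flip: det_mul)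
  ultimately show ?thesis
    by (simp add: zero_less_mult_iff linorder_neq_iff disj_commute)
qed

lemma Q_flow: "Q (flow t *v x) = Q x"
proof -
  have "(cosh t * a - sinh t * b)\<^sup>2 - (cosh t * b - sinh t * a)\<^sup>2
      = ((cosh t)\<^sup>2 - (sinh t)\<^sup>2) * (a\<^sup>2 - b\<^sup>2)" for a b :: real
    by algebra
  then have "(cosh t * a - sinh t * b)\<^sup>2 - (cosh t * b - sinh t * a)\<^sup>2 = a\<^sup>2 - b\<^sup>2" for a b
    by (simp add: cosh_square_eq)
  from this[of "x $ Some None" "x $ None"] show ?thesis
    by (simp add: Q_def sum_UNIV_option flow_mult_nth)
qed

lemma flow_mult_in_SO_Q: "r \<in> SO_Q \<Longrightarrow> flow t ** r \<in> SO_Q"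
  by (simp add: SO_Q_def det_mul det_flow_pos Q_flow flip: matrix_vector_mul_assoc)

text \<open>The minimum is attained, and a vector is as short as its negative. So a short nonzero
  vector may be taken to come from (p, q) with q > 0, that is, from the rational point p/q of the
  sphere.\<close>

lemma \<omega>_less_iff:
  fixes g :: "'n::finite mat2"
  assumes g: "g \<in> SO_Q"
  shows "\<omega> ((\<lambda>v. g *v v) ` \<Lambda>\<^sub>0) < s \<longleftrightarrow>
    (\<exists>p\<in>int_vecs. \<exists>q::nat. q \<ge> 1 \<and> norm p = real q \<and> infnorm (g *v snoc p (real q)) < s)"
    (is "\<omega> ?\<Lambda> < s \<longleftrightarrow> ?R")
proof -
  obtain v where v: "v \<in> ?\<Lambda> - {0}" "infnorm v = \<omega> ?\<Lambda>"
    and least: "\<And>w. w \<in> ?\<Lambda> - {0} \<Longrightarrow> \<omega> ?\<Lambda> \<le> infnorm w"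
    using \<omega>_attained[OF g] by metis
  show ?thesis
  proof
    assume less: "\<omega> ?\<Lambda> < s"
    obtain p a where pa: "snoc p a \<in> \<Lambda>\<^sub>0" "v = g *v snoc p a"
      using v(1) by (metis Diff_iff imageE snoc_cases)
    then have p: "p \<in> int_vecs" "a \<in> \<int>" "norm p = \<bar>a\<bar>"
      by (auto simp: snoc_in_\<Lambda>\<^sub>0_iff)
    \<comment> \<open>On the cone \<open>p\<close> has norm \<bar>a\<bar>, so a zero last coordinate
      would make the whole vector zero.\<close>
    have "a \<noteq> 0"
    proof
      assume "a = 0"
      with p have "snoc p a = 0" by (simp add: vec_eq_iff snoc_def split: option.split)
      with pa v show False by simp
    qed
    moreover obtain z where z: "a = of_int z" using p(2) by (auto elim: Ints_cases)
    ultimately have q: "nat \<bar>z\<bar> \<ge> 1" "real (nat \<bar>z\<bar>) = \<bar>a\<bar>" by auto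
    have "infnorm (g *v snoc (sgn a *\<^sub>R p) \<bar>a\<bar>) < s"
    proof -
      have "snoc (sgn a *\<^sub>R p) \<bar>a\<bar> = sgn a *\<^sub>R snoc p a"
        by (simp add: vec_eq_iff snoc_def abs_sgn mult.commute split: option.split)
      then show ?thesis
        using less v pa \<open>a \<noteq> 0\<close>
        by (simp add: matrix_vector_mult_scaleR infnorm_mul abs_sgn_eq)
    qed
    moreover have "sgn a *\<^sub>R p \<in> int_vecs"
      using p by (auto simp: int_vecs_def sgn_if)
    moreover have "norm (sgn a *\<^sub>R p) = \<bar>a\<bar>"
      using p \<open>a \<noteq> 0\<close> by (simp add: abs_sgn_eq)
    ultimately show ?R using q by metis
  next
    assume ?R
    then obtain p q where p: "p \<in> int_vecs" "q \<ge> (1::nat)" "norm p = real q"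
      "infnorm (g *v snoc p (real q)) < s" by blast
    have "inj ((*v) g)"
      using g by (simp add: SO_Q_def inj_matrix_vector_mult invertible_det_nz)
    moreover have "snoc p (real q) \<noteq> 0"
      using p(2) by (metis snoc_nth(1) zero_index of_nat_eq_0_iff not_one_le_zero)
    ultimately have "g *v snoc p (real q) \<noteq> 0"
      by (metis injD matrix_vector_mult_0_right)
    then have "g *v snoc p (real q) \<in> ?\<Lambda> - {0}"
      using p by (auto simp: snoc_in_\<Lambda>\<^sub>0_iff)
    then show "\<omega> ?\<Lambda> < s" using least p(4) by fastforce
  qed
qed

section \<open>Coordinates of (p, q) after rotation and flow\<close>

lemma rotation_nth:
  fixes \<alpha> :: "'n::finite vec1"
  assumes r: "r \<in> rotations_to_axis \<alpha>" and q: "norm p = q" "q > 0"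
  shows "(r *v snoc p q) $ None = q"
    and "(r *v snoc p q) $ Some None = q - (norm (p - q *\<^sub>R \<alpha>))\<^sup>2 / (2 * q)"
    and "\<bar>(r *v snoc p q) $ Some (Some i)\<bar> \<le> norm (p - q *\<^sub>R \<alpha>)"
proof -
  have axis: "r *v snoc \<alpha> 1 = snoc (axis None 1) 1"
    and Q_r: "\<And>x. Q (r *v x) = Q x"
    using r by (simp_all add: rotations_to_axis_def SO_Q_def)
  obtain y where y: "r *v snoc (p - q *\<^sub>R \<alpha>) 0 = snoc y 0"
    using r unfolding rotations_to_axis_def by blast
  have ny: "norm y = norm (p - q *\<^sub>R \<alpha>)"
    using Q_r[of "snoc (p - q *\<^sub>R \<alpha>) 0"] by (simp add: y Q_snoc)
  \<comment> \<open>Splitting off the multiple of (\<alpha>, 1), whose image is known, leaves a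
    horizontal vector; \<open>r\<close> keeps it horizontal and, preserving \<open>Q\<close>, keeps
    its Euclidean norm.\<close>
  have "snoc p q = snoc (p - q *\<^sub>R \<alpha>) 0 + q *\<^sub>R snoc \<alpha> 1"
    by (simp add: vec_eq_iff snoc_def split: option.split)
  then have rp: "r *v snoc p q = snoc (y + q *\<^sub>R axis None 1) q"
    by (simp add: matrix_vector_right_distrib matrix_vector_mult_scaleR y axis)
      (simp add: vec_eq_iff snoc_def split: option.split)
  \<comment> \<open>The image is isotropic again. Expanding the square by polarization determines
    the first coordinate of \<open>y\<close> from its norm.\<close>
  have "(norm (y + q *\<^sub>R axis None 1))\<^sup>2 = q\<^sup>2"
    using Q_r[of "snoc p q"] q by (simp add: rp Q_snoc)
  then have "2 * q * y $ None = - (norm y)\<^sup>2"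
    using dot_norm[of y "q *\<^sub>R axis None 1"] by (simp add: inner_axis norm_axis_1 power_mult_distrib)
  then have "y $ None = - ((norm y)\<^sup>2 / (2 * q))"
    using q by (simp add: field_simps)
  then show "(r *v snoc p q) $ Some None = q - (norm (p - q *\<^sub>R \<alpha>))\<^sup>2 / (2 * q)"
    by (simp add: rp ny)
  show "(r *v snoc p q) $ None = q" by (simp add: rp)
  show "\<bar>(r *v snoc p q) $ Some (Some i)\<bar> \<le> norm (p - q *\<^sub>R \<alpha>)"
    using component_le_norm_cart[of y "Some i"] by (simp add: rp ny axis_def)
qed

context
  fixes \<alpha> p :: "'n::finite vec1" and r :: "'n mat2" and q t d :: real
  assumes r: "r \<in> rotations_to_axis \<alpha>" and q: "norm p = q" "q > 0"
  defines "d \<equiv> norm (\<alpha> - p /\<^sub>R q)"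
begin

lemma flow_rotation_nth:
  "((flow t ** r) *v snoc p q) $ None = q * (exp (- t) + sinh t * d\<^sup>2 / 2)"
  "((flow t ** r) *v snoc p q) $ Some None = q * (exp (- t) - cosh t * d\<^sup>2 / 2)"
  "\<bar>((flow t ** r) *v snoc p q) $ Some (Some i)\<bar> \<le> q * d"
proof -
  have "p - q *\<^sub>R \<alpha> = (- q) *\<^sub>R (\<alpha> - p /\<^sub>R q)"
    using q(2) by (simp add: algebra_simps)
  then have D: "norm (p - q *\<^sub>R \<alpha>) = q * d"
    using q(2) by (simp add: d_def)
  have exp: "exp (- t) = cosh t - sinh t"
    by (simp add: cosh_minus_sinh)
  have D2: "(q * d)\<^sup>2 / (2 * q) = q * d\<^sup>2 / 2"
    using q(2) by (simp add: power2_eq_square)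
  note nth = rotation_nth[OF r q, unfolded D D2]
  show "((flow t ** r) *v snoc p q) $ None = q * (exp (- t) + sinh t * d\<^sup>2 / 2)"
    "((flow t ** r) *v snoc p q) $ Some None = q * (exp (- t) - cosh t * d\<^sup>2 / 2)"
    by (simp_all add: flow_mult_nth nth exp algebra_simps flip: matrix_vector_mul_assoc)
  show "\<bar>((flow t ** r) *v snoc p q) $ Some (Some i)\<bar> \<le> q * d"
    using nth(3) by (simp add: flow_mult_nth flip: matrix_vector_mul_assoc)
qed

text \<open>Put E = exp(-t), at most 1. After division by q the last coordinate lies between E and
  2E - E^3, the first between -E^3 and E, and the others are at most d < 2E in absolute
  value.\<close>

lemma infnorm_flow_rotation_less:
  assumes t: "t \<ge> 0" and d: "d < 2 * exp (- t)"
  shows "infnorm ((flow t ** r) *v snoc p q) < 2 * (exp (- t) * q)"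
  unfolding infnorm_less_iff
proof
  fix i :: "'n option option"
  define E where "E = exp (- t)"
  have E: "0 < E" "E \<le> 1" using t by (simp_all add: E_def)
  have "d\<^sup>2 < (2 * E)\<^sup>2"
    using d by (intro power_strict_mono) (simp_all add: E_def d_def)
  then have d2: "d\<^sup>2 / 2 < 2 * E\<^sup>2" by (simp add: power_mult_distrib)
  have d0: "0 \<le> d\<^sup>2 / 2" by simp
  \<comment> \<open>Since 2 cosh t = 1/E + E and 2 sinh t = 1/E - E, the bound on half the squared
    distance turns the hyperbolic terms into polynomials in E.\<close>
  have ch: "cosh t * (2 * E\<^sup>2) = E + E ^ 3" and sh: "sinh t * (2 * E\<^sup>2) = E - E ^ 3"
    by (simp_all add: cosh_def sinh_def E_def exp_minus field_simps power2_eq_square power3_eq_cube)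
  have E3: "0 < E ^ 3" "E ^ 3 \<le> E"
    using E power_decreasing[of 1 3 E] by simp_all
  have c: "0 \<le> cosh t * (d\<^sup>2 / 2)" "cosh t * (d\<^sup>2 / 2) < E + E ^ 3"
    using d2 by (simp_all flip: ch)
  have s: "0 \<le> sinh t * (d\<^sup>2 / 2)" "sinh t * (d\<^sup>2 / 2) \<le> E - E ^ 3"
    using t mult_left_mono[OF less_imp_le[OF d2], of "sinh t"] by (simp_all add: sh)
  consider "i = None" | "i = Some None" | j where "i = Some (Some j)"
    by (metis option.exhaust)
  then have "\<bar>((flow t ** r) *v snoc p q) $ i\<bar> < q * (2 * E)"
  proof cases
    case 1
    have "\<bar>E + sinh t * d\<^sup>2 / 2\<bar> < 2 * E" using s E3 E by linarith
    with 1 q show ?thesis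
      by (simp add: flow_rotation_nth abs_mult flip: E_def)
  next
    case 2
    have "\<bar>E - cosh t * d\<^sup>2 / 2\<bar> < 2 * E" using c E3 E by linarith
    with 2 q show ?thesis
      by (simp add: flow_rotation_nth abs_mult flip: E_def)
  next
    case 3
    have "q * d < q * (2 * E)" using d q by (simp add: E_def)
    with 3 flow_rotation_nth(3) show ?thesis by (metis order.strict_trans1)
  qed
  then show "\<bar>((flow t ** r) *v snoc p q) $ i\<bar> < 2 * (exp (- t) * q)"
    by (simp add: E_def mult_ac)
qed

text \<open>The term with sinh t is nonnegative, so the last coordinate alone bounds q. Subtracting
  the first coordinate cancels exp(-t) and combines cosh t + sinh t into exp t, which isolates the
  squared distance.\<close>

lemma bounds_if_infnorm_flow_rotation_less:
  assumes t: "t \<ge> 0" and X: "infnorm ((flow t ** r) *v snoc p q) < exp (- t) * X"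
  shows "q < X" and "d\<^sup>2 < 4 * (exp (- t))\<^sup>2 * (X / q)"
proof -
  have "q * (exp (- t) + sinh t * d\<^sup>2 / 2) < exp (- t) * X"
    and "- (q * (exp (- t) - cosh t * d\<^sup>2 / 2)) < exp (- t) * X"
    using X unfolding infnorm_less_iff by (metis abs_less_iff flow_rotation_nth(1,2))+
  then have last: "q * exp (- t) + q * (sinh t * d\<^sup>2 / 2) < exp (- t) * X"
    and first: "q * (cosh t * d\<^sup>2 / 2) - q * exp (- t) < exp (- t) * X"
    by (simp_all add: algebra_simps)
  have "0 \<le> q * (sinh t * d\<^sup>2 / 2)" using t q(2) by simp
  with last have "exp (- t) * q < exp (- t) * X" by (simp only: mult.commute)
  then show "q < X" by simp
  have "q * ((cosh t + sinh t) * d\<^sup>2 / 2) < 2 * (exp (- t) * X)"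
    using last first by (simp add: algebra_simps)
  then have "q * (exp t * d\<^sup>2 / 2) < 2 * (exp (- t) * X)"
    by (simp only: cosh_plus_sinh)
  then show "d\<^sup>2 < 4 * (exp (- t))\<^sup>2 * (X / q)"
    using q(2) by (simp add: exp_minus field_simps power2_eq_square)
qed

end

section \<open>Approximability through unbounded denominators\<close>

lemma finite_bounded_rational_points:
  "finite {(p :: 'n::finite vec1, q :: nat). p \<in> int_vecs \<and> norm p = real q \<and> q \<le> N}"
  by (rule finite_subset[OF _ finite_cartesian_product[OF
        finite_bounded_int_vecs[of "real N"] finite_atMost[of N]]]) auto

text \<open>Each q admits only finitely many integral p of norm q, so infinitely many solutions
  amount to solutions with arbitrarily large denominator.\<close>

lemma approximable_iff:
  fixes \<alpha> :: "'n::finite vec1"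
  shows "\<alpha> \<in> approximable x0 \<phi> \<longleftrightarrow> \<alpha> \<in> sphere 0 1 \<and>
    (\<forall>N. \<exists>p\<in>int_vecs. \<exists>q::nat. N \<le> q \<and> 1 \<le> q \<and> x0 \<le> real q \<and> norm p = real q \<and>
      infnorm (\<alpha> - p /\<^sub>R real q) < \<phi> (real q))"
proof -
  define S where "S = {(p :: 'n vec1, q :: nat). p \<in> int_vecs \<and> 1 \<le> q \<and> x0 \<le> real q \<and>
    norm p = real q \<and> infnorm (\<alpha> - p /\<^sub>R real q) < \<phi> (real q)}"
  have "p /\<^sub>R real q \<in> sphere 0 1 \<longleftrightarrow> norm p = real q" if "1 \<le> q" for p :: "'n vec1" and q :: nat
    using that by (auto simp: field_simps)
  then have "\<alpha> \<in> approximable x0 \<phi> \<longleftrightarrow> \<alpha> \<in> sphere 0 1 \<and> infinite S"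
    unfolding approximable_def S_def
    by (smt (verit) Collect_cong case_prod_conv cond_case_prod_eta mem_Collect_eq)
  moreover have "infinite S \<longleftrightarrow> (\<forall>N. \<exists>(p, q)\<in>S. N \<le> q)"
  proof
    assume inf: "infinite S"
    show "\<forall>N. \<exists>(p, q)\<in>S. N \<le> q"
    proof (rule ccontr)
      assume "\<not> ?thesis"
      then obtain N where "\<forall>(p, q)\<in>S. q < N"
        by (auto simp: case_prod_unfold not_le)
      then have "S \<subseteq> {(p, q). p \<in> int_vecs \<and> norm p = real q \<and> q \<le> N}"
        by (fastforce simp: S_def)
      with inf show False using finite_bounded_rational_points finite_subset by blast
    qed
  next
    assume unbounded: "\<forall>N. \<exists>(p, q)\<in>S. N \<le> q"
    then have "\<forall>N. \<exists>q\<in>snd ` S. N \<le> q" by force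
    then show "infinite S"
      using finite_nat_set_iff_bounded finite_imageI by (metis not_less)
  qed
  moreover have "(\<forall>N. \<exists>(p, q)\<in>S. N \<le> q) \<longleftrightarrow>
    (\<forall>N. \<exists>p\<in>int_vecs. \<exists>q::nat. N \<le> q \<and> 1 \<le> q \<and> x0 \<le> real q \<and> norm p = real q \<and>
      infnorm (\<alpha> - p /\<^sub>R real q) < \<phi> (real q))"
    by (force simp: S_def)
  ultimately show ?thesis by blast
qed

text \<open>The pairs (m p, m q) are distinct solutions for the same point, each with error zero;
  fractions are counted without reduction to lowest terms.\<close>

lemma approximable_rational:
  fixes p :: "'n::finite vec1"
  assumes p: "p \<in> int_vecs" "norm p = real q" "1 \<le> q" and pos: "\<And>x. x \<ge> x0 \<Longrightarrow> \<psi> x > 0"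
  shows "p /\<^sub>R real q \<in> approximable x0 \<psi>"
  unfolding approximable_iff
proof (intro conjI allI)
  show "p /\<^sub>R real q \<in> sphere 0 1" using p by simp
  fix N :: nat
  \<comment> \<open>\<open>Suc\<close> makes the multiplier positive; since q is at least 1, the
    denominator m q then reaches both \<open>N\<close> and \<open>x0\<close>.\<close>
  define m where "m = Suc (max N (nat \<lceil>x0\<rceil>))"
  have "m \<le> m * q" using p by simp
  then have m: "N \<le> m * q" "1 \<le> m * q" "nat \<lceil>x0\<rceil> \<le> m * q" "0 < m"
    unfolding m_def by linarith+
  then have x0: "x0 \<le> real (m * q)"
    using real_nat_ceiling_ge[of x0] by (meson of_nat_le_iff order.trans)
  have eq: "(real m *\<^sub>R p) /\<^sub>R real (m * q) = p /\<^sub>R real q"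
    using m by simp
  have "infnorm (p /\<^sub>R real q - (real m *\<^sub>R p) /\<^sub>R real (m * q)) < \<psi> (real (m * q))"
    using pos[OF x0] by (simp only: eq diff_self infnorm_0)
  moreover have "real m *\<^sub>R p \<in> int_vecs" using p by (simp add: int_vecs_def)
  ultimately show "\<exists>p'\<in>int_vecs. \<exists>q'::nat. N \<le> q' \<and> 1 \<le> q' \<and> x0 \<le> real q' \<and> norm p' = real q' \<and>
      infnorm (p /\<^sub>R real q - p' /\<^sub>R real q') < \<psi> (real q')"
    using m x0 p by (intro bexI[of _ "real m *\<^sub>R p"] exI[of _ "m * q"]) simp_all
qed

section \<open>Approximations and short vectors along the flow orbit\<close>

theorem theorem1p5:
  fixes x0 t0 :: real and \<phi> \<rho> :: "real \<Rightarrow> real"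
  assumes "x0 > 0"
    and "\<And>x. x \<ge> x0 \<Longrightarrow> \<phi> x > 0"
    and "continuous_on {x0..} \<phi>"
    and "\<And>b. \<phi> piecewise_C1_differentiable_on {x0..b}"
    and "antimono_on {x0..} (\<lambda>x. x * \<phi> x)"
    and "t0 = ln (2 / (sqrt (real (CARD('n::finite) + 1)) * \<phi> x0))"
    and "\<And>t. t \<ge> t0 \<Longrightarrow>
      \<rho> t = exp (- t) * the_inv_into {x0..} \<phi> (2 / (sqrt (real (CARD('n) + 1)) * exp t))"
  shows "antimono_on {t0..} \<rho> \<and>
    (\<forall>\<alpha> \<in> sphere (0 :: 'n vec1) 1. \<forall>r \<in> rotations_to_axis \<alpha>.
      (\<alpha> \<in> approximable x0 \<phi> \<longrightarrow>
        (\<exists>t :: nat \<Rightarrow> real. (\<forall>k. t k \<ge> t0) \<and> filterlim t at_top sequentially \<and>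
          (\<forall>k. \<omega> ((\<lambda>v. (flow (t k) ** r) *v v) ` \<Lambda>\<^sub>0) < 2 * \<rho> (t k)))) \<and>
      ((\<exists>t :: nat \<Rightarrow> real. (\<forall>k. t k \<ge> t0) \<and> filterlim t at_top sequentially \<and>
          (\<forall>k. \<omega> ((\<lambda>v. (flow (t k) ** r) *v v) ` \<Lambda>\<^sub>0) < \<rho> (t k))) \<longrightarrow>
        \<alpha> \<in> approximable x0 (\<lambda>x. sqrt (real (CARD('n) + 1)) * \<phi> x)))"
proof -
  define c where "c = sqrt (real (CARD('n) + 1))"
  have c: "c > 0" by (simp add: c_def)
  note x0 = assms(1) and pos = assms(2)
  have anti: "y * \<phi> y \<le> x * \<phi> x" if "x0 \<le> x" "x \<le> y" for x y
    using assms(5) that by (auto simp: monotone_on_def)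
  have \<phi>_le: "\<phi> y \<le> x0 * \<phi> x0 / y" if "x0 \<le> y" for y
    using anti[of x0 y] that x0 by (simp add: field_simps)
  have \<phi>_less: "\<phi> y < \<phi> x" if "x0 \<le> x" "x < y" for x y
  proof -
    have "y * \<phi> y \<le> x * \<phi> x" using anti that by simp
    also have "\<dots> < y * \<phi> x" using pos that by simp
    finally show ?thesis using that x0 by simp
  qed
  note bij = \<phi>_bij_betw[OF assms(1,2,3,5)]
  define X where "X = (\<lambda>t. the_inv_into {x0..} \<phi> (2 / (c * exp t)))"
  have exp_t0: "exp t0 = 2 / (c * \<phi> x0)"
    using c pos[of x0] by (simp add: assms(6)[folded c_def])
  have \<rho>: "\<rho> t = exp (- t) * X t" if "t0 \<le> t" for t
    using assms(7)[OF that] by (simp add: X_def c_def)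
  have X: "x0 \<le> X t" "\<phi> (X t) = 2 / (c * exp t)" if "t0 \<le> t" for t
  proof -
    have "2 / (c * \<phi> x0) \<le> exp t" using that by (simp flip: exp_t0)
    then have "2 / (c * exp t) \<in> {0<..\<phi> x0}"
      using c pos[of x0] by (simp add: field_simps)
    then show "x0 \<le> X t" "\<phi> (X t) = 2 / (c * exp t)"
      using bij the_inv_into_into[of \<phi> "{x0..}" _ "{x0..}"] f_the_inv_into_f_bij_betw[OF bij]
      by (auto simp: X_def bij_betw_def)
  qed
  \<comment> \<open>\<open>X t\<close> is the denominator scale belonging to time t. As exp(-t) is
    c/2 times \<phi> at \<open>X t\<close>, \<rho> is up to a constant x \<phi>(x) at x =
    \<open>X t\<close>, and inherits its monotonicity.\<close>
  have X_mult: "X t * \<phi> (X t) = 2 / c * \<rho> t" if "t0 \<le> t" for t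
    using X[OF that] by (simp add: \<rho>[OF that] exp_minus field_simps)
  have \<rho>_anti: "\<rho> t \<le> \<rho> s" if "t0 \<le> s" "s \<le> t" for s t
  proof -
    have "\<phi> (X t) \<le> \<phi> (X s)"
      using X that c by (simp add: frac_le)
    then have "X s \<le> X t"
      using \<phi>_less[of "X t" "X s"] X[of t] that by fastforce
    then have "X t * \<phi> (X t) \<le> X s * \<phi> (X s)"
      using X that by (intro anti) auto
    then have "2 / c * \<rho> t \<le> 2 / c * \<rho> s" using X_mult that by simp
    then show ?thesis using c by (simp add: field_simps)
  qed
  \<comment> \<open>The factor sqrt(n+1) is the constant comparing the Euclidean with the supremum
    norm on the ambient space of the sphere.\<close>
  have dist_le: "norm x \<le> c * infnorm x" for x :: "'n vec1"
    using norm_le_infnorm[of x] by (simp add: c_def)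

  have i: "\<exists>t :: nat \<Rightarrow> real. (\<forall>k. t k \<ge> t0) \<and> filterlim t at_top sequentially \<and>
      (\<forall>k. \<omega> ((\<lambda>v. (flow (t k) ** r) *v v) ` \<Lambda>\<^sub>0) < 2 * \<rho> (t k))"
    if r: "r \<in> rotations_to_axis \<alpha>" and \<alpha>: "\<alpha> \<in> approximable x0 \<phi>"
    for \<alpha> :: "'n vec1" and r
  proof -
    have "\<exists>t. t0 \<le> t \<and> real k \<le> t \<and> \<omega> ((\<lambda>v. (flow t ** r) *v v) ` \<Lambda>\<^sub>0) < 2 * \<rho> t" for k :: nat
    proof -
      \<comment> \<open>Since q \<phi>(q) is at most x0 \<phi>(x0), a denominator beyond
        \<open>N\<close> has c \<phi>(q) exp(k) \<le> 2, which puts its time t at k or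
        later.\<close>
      define N where "N = nat \<lceil>x0 * \<phi> x0 * c * exp (real k) / 2\<rceil>"
      obtain p q where p: "p \<in> int_vecs" "N \<le> q" "1 \<le> q" "x0 \<le> real q" "norm p = real q"
        and close: "infnorm (\<alpha> - p /\<^sub>R real q) < \<phi> (real q)"
        using \<alpha> unfolding approximable_iff by blast
      have \<phi>q: "\<phi> (real q) > 0" using pos p by simp
      \<comment> \<open>This is the time whose denominator scale \<open>X t\<close> is exactly
        q.\<close>
      define t where "t = ln (2 / (c * \<phi> (real q)))"
      have exp_t: "exp t = 2 / (c * \<phi> (real q))"
        using c \<phi>q by (simp add: t_def)
      have "\<phi> (real q) \<le> \<phi> x0"
        using \<phi>_less[of x0 "real q"] p by (cases "x0 = real q") auto
      then have "exp t0 \<le> exp t"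
        using c \<phi>q by (simp add: exp_t0 exp_t frac_le)
      then have t0: "t0 \<le> t" by simp
      have "x0 * \<phi> x0 * c * exp (real k) / 2 \<le> real q"
        using p(2) by (simp add: N_def nat_le_iff) linarith
      moreover have "\<phi> (real q) * real q \<le> x0 * \<phi> x0"
        using \<phi>_le[OF p(4)] p(3) by (simp add: field_simps)
      ultimately have "\<phi> (real q) * real q * (c * exp (real k)) \<le> x0 * \<phi> x0 * (c * exp (real k))"
        and "x0 * \<phi> x0 * (c * exp (real k)) \<le> real q * 2"
        using c by (simp_all add: mult_right_mono mult.assoc)
      then have "real q * (\<phi> (real q) * (c * exp (real k))) \<le> real q * 2"
        by (simp add: mult_ac)
      then have "\<phi> (real q) * (c * exp (real k)) \<le> 2"
        using p(3) by simp
      then have "exp (real k) \<le> exp t"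
        using c \<phi>q by (simp add: exp_t field_simps)
      then have k: "real k \<le> t" by simp
      have "\<phi> (X t) = \<phi> (real q)" using X[OF t0] c \<phi>q by (simp add: exp_t)
      then have Xq: "X t = real q"
        using \<phi>_less[of "X t" "real q"] \<phi>_less[of "real q" "X t"] X(1)[OF t0] p(4) by fastforce
      have "norm (\<alpha> - p /\<^sub>R real q) < c * \<phi> (real q)"
        using dist_le[of "\<alpha> - p /\<^sub>R real q"] close c by (smt (verit) mult_less_cancel_left_pos)
      also have "\<dots> = 2 * exp (- t)" by (simp add: exp_minus exp_t)
      finally have "infnorm ((flow t ** r) *v snoc p (real q)) < 2 * (exp (- t) * real q)"
        using k p by (intro infnorm_flow_rotation_less[OF r]) simp_all
      then have "infnorm ((flow t ** r) *v snoc p (real q)) < 2 * \<rho> t"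
        by (simp add: \<rho>[OF t0] Xq)
      moreover have "flow t ** r \<in> SO_Q"
        using r by (simp add: rotations_to_axis_def flow_mult_in_SO_Q)
      ultimately have "\<omega> ((\<lambda>v. (flow t ** r) *v v) ` \<Lambda>\<^sub>0) < 2 * \<rho> t"
        using p by (auto simp: \<omega>_less_iff)
      with t0 k show ?thesis by blast
    qed
    then obtain t where t: "\<And>k :: nat. t0 \<le> t k \<and> real k \<le> t k \<and>
        \<omega> ((\<lambda>v. (flow (t k) ** r) *v v) ` \<Lambda>\<^sub>0) < 2 * \<rho> (t k)"
      by metis
    moreover have "filterlim t at_top sequentially"
      by (rule filterlim_at_top_mono[OF filterlim_real_sequentially]) (use t in simp)
    ultimately show ?thesis by blast
  qed

  have ii: "\<alpha> \<in> approximable x0 (\<lambda>x. c * \<phi> x)"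
    if \<alpha>: "\<alpha> \<in> sphere 0 1" and r: "r \<in> rotations_to_axis \<alpha>" and t: "\<And>k. t k \<ge> t0"
      "filterlim t at_top sequentially" "\<And>k. \<omega> ((\<lambda>v. (flow (t k) ** r) *v v) ` \<Lambda>\<^sub>0) < \<rho> (t k)"
    for \<alpha> :: "'n vec1" and r and t :: "nat \<Rightarrow> real"
  \<comment> \<open>For a rational \<alpha> the same pair (p, q) may supply the short vectors at all
    large times, so the denominators need not grow.\<close>
  proof (cases "\<exists>p\<in>int_vecs. \<exists>q::nat. 1 \<le> q \<and> norm p = real q \<and> \<alpha> = p /\<^sub>R real q")
    case True
    moreover have "c * \<phi> x > 0" if "x0 \<le> x" for x
      using c pos[OF that] by simp
    ultimately show ?thesis
      using approximable_rational[where ?x0.0 = x0 and \<psi> = "\<lambda>x. c * \<phi> x"] by metis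
  next
    case irrational: False
    have "\<exists>p\<in>int_vecs. \<exists>q::nat. N \<le> q \<and> 1 \<le> q \<and> x0 \<le> real q \<and> norm p = real q \<and>
      infnorm (\<alpha> - p /\<^sub>R real q) < c * \<phi> (real q)" for N :: nat
    proof -
      define M where "M = max N (nat \<lceil>x0\<rceil>)"
      define F where "F = {(p :: 'n vec1, q :: nat). p \<in> int_vecs \<and> norm p = real q \<and> q \<le> M} \<inter>
        {(p, q). 1 \<le> q}"
      \<comment> \<open>An irrational \<alpha> keeps a positive distance \<delta> from the finitely
        many rational points with denominator at most \<open>M\<close>; an error below \<delta>
        therefore forces q > \<open>M\<close>.\<close>
      have "finite F" unfolding F_def using finite_bounded_rational_points by blast
      then have "finite ((\<lambda>(p, q). norm (\<alpha> - p /\<^sub>R real q)) ` F)" by simp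
      moreover have "0 \<notin> (\<lambda>(p, q). norm (\<alpha> - p /\<^sub>R real q)) ` F"
        using irrational by (auto simp: F_def)
      ultimately obtain \<delta> where \<delta>: "\<delta> > 0" "\<And>p q. (p, q) \<in> F \<Longrightarrow> \<delta> \<le> norm (\<alpha> - p /\<^sub>R real q)"
        using finite_set_avoid[of "(\<lambda>(p, q). norm (\<alpha> - p /\<^sub>R real q)) ` F" 0] by (force simp: dist_norm)
      \<comment> \<open>This expression will dominate the squared error at time s, so late times
        push the error below \<delta>.\<close>
      have "((\<lambda>s. 4 * exp (- s) * \<rho> t0) \<longlongrightarrow> 4 * 0 * \<rho> t0) at_top"
        by (intro tendsto_intros filterlim_compose[OF exp_at_bot filterlim_uminus_at_bot_at_top])
      then have "eventually (\<lambda>s. 4 * exp (- s) * \<rho> t0 < \<delta>\<^sup>2 \<and> 0 \<le> s) at_top"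
        using order_tendstoD(2)[of _ _ _ "\<delta>\<^sup>2"] \<delta>(1)
        by (intro eventually_conj eventually_ge_at_top) fastforce
      then have "eventually (\<lambda>k. 4 * exp (- t k) * \<rho> t0 < \<delta>\<^sup>2 \<and> 0 \<le> t k) sequentially"
        using t(2) by (auto simp: filterlim_iff)
      then obtain k where k: "4 * exp (- t k) * \<rho> t0 < \<delta>\<^sup>2" "0 \<le> t k"
        by (metis (mono_tags, lifting) eventually_sequentially order_refl)
      define E where "E = exp (- t k)"
      define Y where "Y = X (t k)"
      have Y: "x0 \<le> Y" "\<phi> Y = 2 * E / c" "\<rho> (t k) = E * Y"
        using X[of "t k"] \<rho>[of "t k"] t(1) by (simp_all add: Y_def E_def exp_minus field_simps)
      have "flow (t k) ** r \<in> SO_Q"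
        using r by (simp add: rotations_to_axis_def flow_mult_in_SO_Q)
      then obtain p q where p: "p \<in> int_vecs" "1 \<le> q" "norm p = real q"
        and short: "infnorm ((flow (t k) ** r) *v snoc p (real q)) < exp (- t k) * Y"
        using t(3)[of k] Y(3) by (auto simp: \<omega>_less_iff E_def)
      define d where "d = norm (\<alpha> - p /\<^sub>R real q)"
      have q: "real q > 0" using p by simp
      note bounds = bounds_if_infnorm_flow_rotation_less[OF r p(3) q k(2) short, folded d_def E_def]
      \<comment> \<open>A crude bound first: q \<ge> 1 and \<rho> is at most its value at
        \<open>t0\<close>. It only serves to make q large.\<close>
      have "d\<^sup>2 < 4 * E * (E * Y) / real q"
        using bounds(2) by (simp add: power2_eq_square mult_ac)
      also have "\<dots> \<le> 4 * E * (E * Y)"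
        using p(2) Y(1) x0 divide_left_mono[of 1 "real q" "4 * E * (E * Y)"] by (simp add: E_def)
      also have "\<dots> \<le> 4 * E * \<rho> t0"
        using \<rho>_anti[of t0 "t k"] t(1)[of k] by (simp add: Y(3) E_def)
      also have "\<dots> < \<delta>\<^sup>2" using k by (simp add: E_def)
      finally have "d < \<delta>" using \<delta>(1) by (simp add: power_less_imp_less_base)
      then have "(p, q) \<notin> F" using \<delta>(2)[of p q] by (auto simp: d_def)
      then have "M < q" using p by (auto simp: F_def)
      then have qN: "N \<le> q" "x0 \<le> real q"
        unfolding M_def by linarith+
      \<comment> \<open>Now the sharp bound. A ratio above 1 is below its square, so the estimate
        for the squared distance can be enlarged to a perfect square.\<close>
      have "1 < Y / real q" using bounds(1) q by simp
      then have "Y / real q < (Y / real q)\<^sup>2"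
        using power_strict_increasing[of 1 2 "Y / real q"] by simp
      then have "4 * E\<^sup>2 * (Y / real q) < 4 * E\<^sup>2 * (Y / real q)\<^sup>2"
        by (rule mult_strict_left_mono) (simp add: E_def)
      also have "\<dots> = (2 * E * Y / real q)\<^sup>2"
        by (simp add: power_mult_distrib power_divide)
      finally have "d\<^sup>2 < (2 * E * Y / real q)\<^sup>2"
        using bounds(2) by (rule order.strict_trans[rotated])
      then have "d < 2 * E * Y / real q"
        by (rule power_less_imp_less_base) (use q Y(1) x0 in \<open>simp add: E_def\<close>)
      \<comment> \<open>Here 2E = c \<phi>(Y); as q < Y, monotonicity of x \<phi>(x) then replaces Y
        by q.\<close>
      also have "\<dots> = c * (Y * \<phi> Y) / real q" using c by (simp add: Y(2))
      also have "\<dots> \<le> c * (real q * \<phi> (real q)) / real q"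
        using anti[of "real q" Y] qN bounds(1) c q by (intro divide_right_mono mult_left_mono) simp_all
      also have "\<dots> = c * \<phi> (real q)" using q by simp
      finally have "infnorm (\<alpha> - p /\<^sub>R real q) < c * \<phi> (real q)"
        using infnorm_le_norm[of "\<alpha> - p /\<^sub>R real q"] by (simp add: d_def)
      with p qN show ?thesis by blast
    qed
    with \<alpha> show ?thesis by (simp add: approximable_iff)
  qed

  have "antimono_on {t0..} \<rho>"
    using \<rho>_anti by (simp add: monotone_on_def)
  then show ?thesis
    using i ii unfolding c_def by blast
qed

end
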